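(* Let $(\tau_t)$ be a quantum dynamical semigroup on a von Neumann algebra $\mathcal{A}_0$ acting on a separable Hilbert space $\mathcal{H}_0$. Let $p\in\mathcal{A}_0$ be a sub-harmonic projection for $(\tau_t)$ and let $y=\mathrm{s.lim}_{t\to\infty}\tau_t(p)$. If $y\ge\lambda 1$ for some real $\lambda>0$, then $y=1$.
   Context: A quantum dynamical semigroup $(\tau_t)$ on a von Neumann algebra $\mathcal{A}_0$ acting on a separable Hilbert space $\mathcal{H}_0$ is a one-parameter semigroup of identity-preserving (unital), normal, completely positive maps $\tau_t:\mathcal{A}_0\to\mathcal{A}_0$, where $t$ ranges either over the nonnegative reals or over the nonnegative integers, such that $t\mapsto\tau_t(x)$ is weak$^*$ continuous for each $x\in\mathcal{A}_0$. A projection $p\in\mathcal{A}_0$ is sub-harmonic if $\tau_t(p)\ge p$ for all $t\ge 0$. For such $p$ the operators $\tau_t(p)$ are increasing in $t$ and bounded by $1$, so the strong limit $y=\mathrm{s.lim}_{t\to\infty}\tau_t(p)$ exists and $0\le y\le 1$. *)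

theory Defs
  imports "HOL-Analysis.Analysis"
begin

text \<open>
  Complex Hilbert spaces.  Norm, topology and completeness are those of the underlying real Hilbert
  space, whose inner product is the real part of the complex one; hence
  \<open>norm x = sqrt (Re (cinner x x))\<close>.  The complex inner product is linear in its first argument.
\<close>

class chilbert_space = real_inner + complete_space +
  fixes scaleC :: "complex \<Rightarrow> 'a \<Rightarrow> 'a"
    and cinner :: "'a \<Rightarrow> 'a \<Rightarrow> complex"
  assumes scaleC_add_right: "scaleC c (x + y) = scaleC c x + scaleC c y"
    and scaleC_add_left: "scaleC (c + d) x = scaleC c x + scaleC d x"
    and scaleC_scaleC: "scaleC c (scaleC d x) = scaleC (c * d) x"
    and scaleC_of_real: "scaleC (complex_of_real r) x = r *\<^sub>R x"
    and cinner_commute: "cinner x y = cnj (cinner y x)"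
    and cinner_add_left: "cinner (x + y) z = cinner x z + cinner y z"
    and cinner_scaleC_left: "cinner (scaleC c x) y = c * cinner x y"
    and Re_cinner: "Re (cinner x y) = x \<bullet> y"

lemma norm_scaleC: "norm (scaleC c x) = cmod c * norm (x :: 'a::chilbert_space)"
proof -
  have "cinner (scaleC c x) (scaleC c x) = c * cnj c * cinner x x"
    by (subst cinner_scaleC_left, subst cinner_commute, subst cinner_scaleC_left)
      (simp add: cinner_commute[of x x, symmetric])
  also have "c * cnj c = complex_of_real ((cmod c)\<^sup>2)"
    by (simp only: complex_norm_square)
  finally have "scaleC c x \<bullet> scaleC c x = (cmod c)\<^sup>2 * (x \<bullet> x)"
    by (simp add: Re_cinner[symmetric])
  then have "(norm (scaleC c x))\<^sup>2 = (cmod c * norm x)\<^sup>2"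
    by (simp add: power2_norm_eq_inner power_mult_distrib)
  then show ?thesis
    by (rule power2_eq_imp_eq) auto
qed

lemma bounded_linear_scaleC:
  "bounded_linear (scaleC c :: 'a \<Rightarrow> 'a::chilbert_space)"
proof (rule bounded_linear_intro[where K = "cmod c"])
  show "scaleC c (r *\<^sub>R x) = r *\<^sub>R scaleC c x" for r and x :: 'a
    by (simp add: scaleC_of_real[symmetric] scaleC_scaleC mult.commute)
qed (simp_all add: scaleC_add_right norm_scaleC mult.commute)

text \<open>
  Bounded operators on the Hilbert space are the complex-linear elements of the (real) type of
  bounded linear maps.
\<close>

definition bounded_ops :: "('h::chilbert_space \<Rightarrow>\<^sub>L 'h) set"
  where "bounded_ops = {S. \<forall>c x. blinfun_apply S (scaleC c x) = scaleC c (blinfun_apply S x)}"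

lift_definition scale_op :: "complex \<Rightarrow> ('h::chilbert_space \<Rightarrow>\<^sub>L 'h) \<Rightarrow> ('h \<Rightarrow>\<^sub>L 'h)"
  is "\<lambda>c S x. scaleC c (S x)"
  by (rule bounded_linear_compose[OF bounded_linear_scaleC])

text \<open>\<open>R\<close> is the adjoint of \<open>S\<close>; as a relation, to avoid a description operator.\<close>

definition is_adjoint :: "('h::chilbert_space \<Rightarrow>\<^sub>L 'h) \<Rightarrow> ('h \<Rightarrow>\<^sub>L 'h) \<Rightarrow> bool"
  where "is_adjoint S R \<longleftrightarrow>
    (\<forall>x z. cinner (blinfun_apply S x) z = cinner x (blinfun_apply R z))"

definition positive_op :: "('h::chilbert_space \<Rightarrow>\<^sub>L 'h) \<Rightarrow> bool"
  where "positive_op S \<longleftrightarrow> (\<forall>x. cinner (blinfun_apply S x) x \<in> \<real>\<^sub>\<ge>\<^sub>0)"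

definition op_le :: "('h::chilbert_space \<Rightarrow>\<^sub>L 'h) \<Rightarrow> ('h \<Rightarrow>\<^sub>L 'h) \<Rightarrow> bool"
  where "op_le S R \<longleftrightarrow> positive_op (R - S)"

definition projection_op :: "('h::chilbert_space \<Rightarrow>\<^sub>L 'h) \<Rightarrow> bool"
  where "projection_op q \<longleftrightarrow> q \<in> bounded_ops \<and> q o\<^sub>L q = q \<and> is_adjoint q q"

definition von_neumann_algebra :: "('h::chilbert_space \<Rightarrow>\<^sub>L 'h) set \<Rightarrow> bool"
  where "von_neumann_algebra A \<longleftrightarrow>
    A \<subseteq> bounded_ops \<and> id_blinfun \<in> A \<and>
    (\<forall>S\<in>A. \<forall>R\<in>A. S + R \<in> A \<and> S o\<^sub>L R \<in> A) \<and>
    (\<forall>c. \<forall>S\<in>A. scale_op c S \<in> A) \<and>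
    (\<forall>S\<in>A. \<exists>R\<in>A. is_adjoint S R) \<and>
    closedin strong_operator_topology A"

text \<open>
  The weak* topology of a von Neumann algebra is the restriction of the ultraweak topology: the
  coarsest one making all functionals \<open>S \<mapsto> (\<Sum>n. \<langle>S (\<xi> n), \<eta> n\<rangle>)\<close> with square-summable \<open>\<xi>\<close> and \<open>\<eta>\<close>
  continuous (these functionals form the predual).
\<close>

definition ultraweak_topology :: "('h::chilbert_space \<Rightarrow>\<^sub>L 'h) topology"
  where "ultraweak_topology = topology_generated_by
    {{S. (\<Sum>n. cinner (blinfun_apply S (\<xi> n)) (\<eta> n)) \<in> U} | \<xi> \<eta> U.
      summable (\<lambda>n::nat. (norm (\<xi> n))\<^sup>2) \<and> summable (\<lambda>n. (norm (\<eta> n))\<^sup>2) \<and> open U}"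

abbreviation weak_star :: "('h::chilbert_space \<Rightarrow>\<^sub>L 'h) set \<Rightarrow> ('h \<Rightarrow>\<^sub>L 'h) topology"
  where "weak_star A \<equiv> subtopology ultraweak_topology A"

definition linear_map_on ::
    "('h::chilbert_space \<Rightarrow>\<^sub>L 'h) set \<Rightarrow> (('h \<Rightarrow>\<^sub>L 'h) \<Rightarrow> ('h \<Rightarrow>\<^sub>L 'h)) \<Rightarrow> bool"
  where "linear_map_on A f \<longleftrightarrow>
    (\<forall>S\<in>A. \<forall>R\<in>A. f (S + R) = f S + f R) \<and> (\<forall>c. \<forall>S\<in>A. f (scale_op c S) = scale_op c (f S))"

text \<open>An \<open>n \<times> n\<close> operator matrix \<open>a\<close> acting on the \<open>n\<close>-fold direct sum of the Hilbert space.\<close>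

definition positive_op_matrix :: "nat \<Rightarrow> (nat \<Rightarrow> nat \<Rightarrow> ('h::chilbert_space \<Rightarrow>\<^sub>L 'h)) \<Rightarrow> bool"
  where "positive_op_matrix n a \<longleftrightarrow>
    (\<forall>\<xi>. (\<Sum>i<n. cinner (\<Sum>j<n. blinfun_apply (a i j) (\<xi> j)) (\<xi> i)) \<in> \<real>\<^sub>\<ge>\<^sub>0)"

definition completely_positive_on ::
    "('h::chilbert_space \<Rightarrow>\<^sub>L 'h) set \<Rightarrow> (('h \<Rightarrow>\<^sub>L 'h) \<Rightarrow> ('h \<Rightarrow>\<^sub>L 'h)) \<Rightarrow> bool"
  where "completely_positive_on A f \<longleftrightarrow> linear_map_on A f \<and>
    (\<forall>n a. (\<forall>i<n. \<forall>j<n. a i j \<in> A) \<and> positive_op_matrix n a \<longrightarrow>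
      positive_op_matrix n (\<lambda>i j. f (a i j)))"

text \<open>
  \<open>I\<close> is the set of times, either the nonnegative reals or the nonnegative integers (as a subset of
  the reals, where continuity in time is vacuous).  A linear map of \<open>A\<close> is normal if it is
  weak*-continuous.
\<close>

definition quantum_dynamical_semigroup ::
    "real set \<Rightarrow> ('h::chilbert_space \<Rightarrow>\<^sub>L 'h) set \<Rightarrow> (real \<Rightarrow> ('h \<Rightarrow>\<^sub>L 'h) \<Rightarrow> ('h \<Rightarrow>\<^sub>L 'h)) \<Rightarrow> bool"
  where "quantum_dynamical_semigroup I A \<tau> \<longleftrightarrow>
    (I = {0..} \<or> I = \<nat>) \<and>
    (\<forall>t\<in>I. \<tau> t \<in> A \<rightarrow> A \<and> \<tau> t id_blinfun = id_blinfun \<and> completely_positive_on A (\<tau> t) \<and>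
      continuous_map (weak_star A) (weak_star A) (\<tau> t)) \<and>
    (\<forall>x\<in>A. \<tau> 0 x = x) \<and>
    (\<forall>s\<in>I. \<forall>t\<in>I. \<forall>x\<in>A. \<tau> (s + t) x = \<tau> s (\<tau> t x)) \<and>
    (\<forall>x\<in>A. continuous_map (top_of_set I) (weak_star A) (\<lambda>t. \<tau> t x))"

definition subharmonic_projection ::
    "real set \<Rightarrow> ('h::chilbert_space \<Rightarrow>\<^sub>L 'h) set \<Rightarrow> (real \<Rightarrow> ('h \<Rightarrow>\<^sub>L 'h) \<Rightarrow> ('h \<Rightarrow>\<^sub>L 'h)) \<Rightarrow>
      ('h \<Rightarrow>\<^sub>L 'h) \<Rightarrow> bool"
  where "subharmonic_projection I A \<tau> p \<longleftrightarrow>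
    p \<in> A \<and> projection_op p \<and> (\<forall>t\<in>I. op_le p (\<tau> t p))"

definition is_strong_limit ::
    "real set \<Rightarrow> (real \<Rightarrow> ('h::chilbert_space \<Rightarrow>\<^sub>L 'h)) \<Rightarrow> ('h \<Rightarrow>\<^sub>L 'h) \<Rightarrow> bool"
  where "is_strong_limit I f S \<longleftrightarrow>
    limitin strong_operator_topology f S (inf at_top (principal I))"

end

theory Submission
  imports Defs
begin

text \<open>
  Write \<open>w = 1 - y\<close> for the defect of the limit.  The theorem is a contraction argument: the
  semigroup fixes \<open>w\<close>, while positivity of its maps shows \<open>w \<le> (1 - lam) w\<close>.

  The map \<open>\<tau> s\<close> fixes \<open>y\<close> because \<open>\<tau> s (\<tau> t p) = \<tau> (s + t) p\<close> and both sides converge as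
  \<open>t\<close> grows.  On the left this is normality, which is weak* continuity, so the strong limit has to
  be seen as a weak* limit; that is legitimate since the operators \<open>\<tau> t p\<close> lie between \<open>0\<close> and
  \<open>1\<close>, and dominated convergence applies to the functionals of the predual
  (\<open>limitin_ultraweak_of_strong\<close>).

  Next, \<open>p \<le> y \<le> 1\<close> gives \<open>0 \<le> w \<le> 1 - p\<close>, so \<open>w\<close> vanishes on the range of \<open>p\<close> and is
  supported on that of \<open>1 - p\<close>.  There \<open>w \<le> (1 - lam) 1\<close>, so that
  \<open>w \<le> (1 - lam) (1 - p)\<close> (\<open>op_le_corner\<close>).  Applying the positive unital map \<open>\<tau> t\<close>
  yields \<open>w \<le> (1 - lam) (1 - \<tau> t p)\<close>, and letting \<open>t\<close> grow yields \<open>w \<le> (1 - lam) w\<close>.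
  As \<open>lam > 0\<close>, the quadratic form of \<open>w\<close> is zero, hence \<open>w = 0\<close> by polarization.
\<close>

section \<open>The complex inner product\<close>

text \<open>
  The imaginary part of the complex inner product is a real inner product as well.  Through this
  formula, continuity and real bilinearity are inherited from the real inner product.
\<close>

lemma Im_cinner: "Im (cinner x y) = scaleC (- \<i>) x \<bullet> (y :: 'h::chilbert_space)"
  by (simp flip: Re_cinner add: cinner_scaleC_left)

lemma cinner_add_right: "cinner x (y + z) = cinner x y + cinner x (z :: 'h::chilbert_space)"
  by (simp add: complex_eq_iff Re_cinner Im_cinner inner_add_right)

lemma cinner_scaleC_right: "cinner x (scaleC c y) = cnj c * cinner x (y :: 'h::chilbert_space)"
proof -
  have "cinner x (scaleC c y) = cnj (c * cinner y x)"
    by (metis cinner_commute cinner_scaleC_left)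
  also have "\<dots> = cnj c * cinner x y"
    by (simp add: cinner_commute[of x y])
  finally show ?thesis .
qed

lemma scaleC_diff_right: "scaleC c (x - y) = scaleC c x - scaleC c (y :: 'h::chilbert_space)"
  using bounded_linear_scaleC by (rule linear_simps)

interpretation cinner: bounded_bilinear "cinner :: 'h::chilbert_space \<Rightarrow> 'h \<Rightarrow> complex"
proof
  fix x x' y y' :: 'h and r :: real
  show "cinner (x + x') y = cinner x y + cinner x' y"
    by (rule cinner_add_left)
  show "cinner x (y + y') = cinner x y + cinner x y'"
    by (rule cinner_add_right)
  show "cinner (r *\<^sub>R x) y = r *\<^sub>R cinner x y"
    by (simp flip: scaleC_of_real add: cinner_scaleC_left scaleR_conv_of_real)
  show "cinner x (r *\<^sub>R y) = r *\<^sub>R cinner x y"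
    by (simp add: complex_eq_iff Re_cinner Im_cinner)
  have "cmod (cinner a b) \<le> norm a * norm b * 2" for a b :: 'h
  proof -
    have "cmod (cinner a b) \<le> \<bar>a \<bullet> b\<bar> + \<bar>scaleC (- \<i>) a \<bullet> b\<bar>"
      using cmod_le[of "cinner a b"] by (simp add: Re_cinner Im_cinner)
    also have "\<dots> \<le> norm a * norm b + norm (scaleC (- \<i>) a) * norm b"
      by (intro add_mono Cauchy_Schwarz_ineq2)
    finally show ?thesis by (simp add: norm_scaleC)
  qed
  then show "\<exists>K. \<forall>a b :: 'h. norm (cinner a b) \<le> norm a * norm b * K"
    by blast
qed

section \<open>Quadratic forms of operators\<close>

lemma positive_op_iff:
  "positive_op S \<longleftrightarrow> (\<forall>x. Im (cinner (blinfun_apply S x) x) = 0 \<and> 0 \<le> blinfun_apply S x \<bullet> x)"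
  unfolding positive_op_def complex_nonneg_Reals_iff Re_cinner by auto

lemma cinner_polarization:
  fixes T :: "'h::chilbert_space \<Rightarrow>\<^sub>L 'h"
  assumes "T \<in> bounded_ops"
  defines "Q \<equiv> \<lambda>x z. cinner (blinfun_apply T (x + z)) (x + z)
                - cinner (blinfun_apply T x) x - cinner (blinfun_apply T z) z"
  shows "2 * cinner (blinfun_apply T x) z = Q x z - \<i> * Q (scaleC \<i> x) z"
proof -
  have T: "blinfun_apply T (scaleC \<i> x) = scaleC \<i> (blinfun_apply T x)"
    using assms(1) by (simp add: bounded_ops_def)
  have "Q u v = cinner (blinfun_apply T u) v + cinner (blinfun_apply T v) u" for u v
    by (simp add: Q_def blinfun.add_right cinner.add_left cinner.add_right)
  then show ?thesis
    by (simp add: T cinner_scaleC_left cinner_scaleC_right algebra_simps)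
qed

text \<open>
  Complex linearity is essential here: rotation of the real plane by a right angle has zero real
  quadratic form.
\<close>

lemma op_eq_0_if_form_0:
  fixes T :: "'h::chilbert_space \<Rightarrow>\<^sub>L 'h"
  assumes "T \<in> bounded_ops" and "\<And>x. cinner (blinfun_apply T x) x = 0"
  shows "T = 0"
proof (rule blinfun_eqI)
  fix x
  have "cinner (blinfun_apply T x) (blinfun_apply T x) = 0"
    using cinner_polarization[OF assms(1), of x "blinfun_apply T x"] assms(2) by simp
  then have "blinfun_apply T x \<bullet> blinfun_apply T x = 0"
    by (metis Re_cinner zero_complex.simps(1))
  then show "blinfun_apply T x = blinfun_apply 0 x" by simp
qed

text \<open>
  The additive bound on the right is what the predual needs: it is summable along any two
  square-summable sequences.
\<close>

lemma cmod_cinner_le_if_form_le: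
  fixes T :: "'h::chilbert_space \<Rightarrow>\<^sub>L 'h"
  assumes "T \<in> bounded_ops" and "\<And>x. cmod (cinner (blinfun_apply T x) x) \<le> (norm x)\<^sup>2"
  shows "cmod (cinner (blinfun_apply T x) z) \<le> 3 * ((norm x)\<^sup>2 + (norm z)\<^sup>2)"
proof -
  define Q where "Q = (\<lambda>x z. cinner (blinfun_apply T (x + z)) (x + z)
                - cinner (blinfun_apply T x) x - cinner (blinfun_apply T z) z)"
  have Q: "cmod (Q u v) \<le> 3 * ((norm u)\<^sup>2 + (norm v)\<^sup>2)" for u v
  proof -
    have "cmod (Q u v) \<le> cmod (cinner (blinfun_apply T (u + v)) (u + v))
        + cmod (cinner (blinfun_apply T u) u) + cmod (cinner (blinfun_apply T v) v)"
      unfolding Q_def by (meson add_mono norm_triangle_ineq4 order.trans order_refl)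
    also have "\<dots> \<le> (norm (u + v))\<^sup>2 + (norm u)\<^sup>2 + (norm v)\<^sup>2"
      by (intro add_mono assms(2))
    also have "(norm (u + v))\<^sup>2 \<le> (norm u + norm v)\<^sup>2"
      by (simp add: norm_triangle_ineq power_mono)
    also have "\<dots> \<le> 2 * ((norm u)\<^sup>2 + (norm v)\<^sup>2)"
      using zero_le_power2[of "norm u - norm v"] by (simp add: power2_eq_square algebra_simps)
    finally show ?thesis by simp
  qed
  have "2 * cmod (cinner (blinfun_apply T x) z) = cmod (Q x z - \<i> * Q (scaleC \<i> x) z)"
    using arg_cong[OF cinner_polarization[OF assms(1), of x z], of cmod]
    by (simp add: Q_def norm_mult)
  also have "\<dots> \<le> cmod (Q x z) + cmod (Q (scaleC \<i> x) z)"
    using norm_triangle_ineq4[of "Q x z" "\<i> * Q (scaleC \<i> x) z"] by (simp add: norm_mult)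
  finally show ?thesis
    using Q[of x z] Q[of "scaleC \<i> x" z] by (simp add: norm_scaleC)
qed

lemma form_le_if_between_0_and_id:
  assumes "positive_op T" and "op_le T id_blinfun"
  shows "cmod (cinner (blinfun_apply T x) x) \<le> (norm x)\<^sup>2"
proof -
  have im: "Im (cinner (blinfun_apply T x) x) = 0" and re: "0 \<le> blinfun_apply T x \<bullet> x"
    using assms(1) by (auto simp: positive_op_iff)
  have "0 \<le> blinfun_apply (id_blinfun - T) x \<bullet> x"
    using assms(2) unfolding op_le_def positive_op_iff by blast
  then have "blinfun_apply T x \<bullet> x \<le> (norm x)\<^sup>2"
    by (simp add: blinfun.diff_left inner_diff_left power2_norm_eq_inner)
  with im re show ?thesis
    by (simp add: cmod_def Re_cinner)
qed

text \<open>
  Along the line through \<open>u\<close> in direction \<open>v\<close>, the form is affine because its quadratic coefficient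
  is zero.  An affine function bounded below is constant.
\<close>

lemma positive_form_cross_terms_0:
  fixes S :: "'h::chilbert_space \<Rightarrow>\<^sub>L 'h"
  assumes "positive_op S" and "blinfun_apply S v \<bullet> v = 0"
  shows "blinfun_apply S v \<bullet> u + blinfun_apply S u \<bullet> v = 0"
proof (rule ccontr)
  define c where "c = blinfun_apply S v \<bullet> u + blinfun_apply S u \<bullet> v"
  define q where "q = blinfun_apply S u \<bullet> u"
  assume "blinfun_apply S v \<bullet> u + blinfun_apply S u \<bullet> v \<noteq> 0"
  then have c: "c \<noteq> 0" by (simp add: c_def)
  have "0 \<le> blinfun_apply S (u + r *\<^sub>R v) \<bullet> (u + r *\<^sub>R v)" for r
    using assms(1) by (simp add: positive_op_iff)
  then have "0 \<le> q + r * c" for r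
    using assms(2)
    by (simp add: blinfun.add_right blinfun.scaleR_right inner_add_left inner_add_right
        c_def q_def algebra_simps)
  \<comment> \<open>At this parameter the affine function takes the value \<open>- 1\<close>.\<close>
  from this[of "- (q + 1) / c"] c show False by simp
qed

lemma cinner_self_nonneg: "cinner x x \<in> \<real>\<^sub>\<ge>\<^sub>0" for x :: "'h::chilbert_space"
  using cinner_commute[of x x] by (auto simp: complex_nonneg_Reals_iff Re_cinner complex_eq_iff)

lemma cinner_projection_op:
  assumes "projection_op q"
  shows "cinner (blinfun_apply q x) x = cinner (blinfun_apply q x) (blinfun_apply q x)"
  using assms unfolding projection_op_def is_adjoint_def by (metis blinfun_apply_blinfun_compose)

lemma projection_op_positive: "projection_op q \<Longrightarrow> positive_op q"
  by (simp add: positive_op_def cinner_projection_op cinner_self_nonneg)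

lemma projection_op_compl:
  fixes q :: "'h::chilbert_space \<Rightarrow>\<^sub>L 'h"
  assumes "projection_op q"
  shows "projection_op (id_blinfun - q)"
proof -
  have "blinfun_apply q (blinfun_apply q x) = blinfun_apply q x" for x
    using assms unfolding projection_op_def by (metis blinfun_apply_blinfun_compose)
  then have "(id_blinfun - q) o\<^sub>L (id_blinfun - q) = id_blinfun - q"
    by (intro blinfun_eqI) (simp add: blinfun.diff_left blinfun.diff_right)
  then show ?thesis
    using assms unfolding projection_op_def is_adjoint_def bounded_ops_def
    by (simp add: blinfun.diff_left cinner.diff_left cinner.diff_right scaleC_diff_right)
qed

text \<open>
  An operator below \<open>1 - p\<close> lives on the range of \<open>1 - p\<close>, so a scalar bound for it need only be
  paid there.
\<close>

lemma op_le_corner: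
  fixes w p :: "'h::chilbert_space \<Rightarrow>\<^sub>L 'h"
  assumes p: "projection_op p"
    and w: "positive_op w" "op_le w (id_blinfun - p)" "op_le w (c *\<^sub>R id_blinfun)"
  shows "op_le w (c *\<^sub>R (id_blinfun - p))"
proof -
  have pp: "blinfun_apply p (blinfun_apply p x) = blinfun_apply p x" for x
    using p unfolding projection_op_def by (metis blinfun_apply_blinfun_compose)
  have id_real: "Im (cinner x x) = 0" for x :: 'h
    using cinner_self_nonneg[of x] by (simp add: complex_nonneg_Reals_iff)
  have p_real: "Im (cinner (blinfun_apply p x) x) = 0" for x
    using projection_op_positive[OF p] by (simp add: positive_op_iff)
  have w_real: "Im (cinner (blinfun_apply w x) x) = 0"
    and w_pos: "0 \<le> blinfun_apply w x \<bullet> x" for x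
    using w(1) by (auto simp: positive_op_iff)
  have w_le: "blinfun_apply w x \<bullet> x \<le> x \<bullet> x - blinfun_apply p x \<bullet> x"
    and w_le_c: "blinfun_apply w x \<bullet> x \<le> c * (x \<bullet> x)" for x
    using w(2,3)
    by (auto simp: op_le_def positive_op_iff blinfun.diff_left blinfun.scaleR_left inner_diff_left)
  show ?thesis
    unfolding op_le_def positive_op_iff
  proof (intro allI conjI)
    fix x
    show "Im (cinner (blinfun_apply (c *\<^sub>R (id_blinfun - p) - w) x) x) = 0"
      by (simp add: blinfun.diff_left blinfun.scaleR_left cinner.diff_left cinner.scaleR_left
          p_real id_real w_real)
    define v u where "v = blinfun_apply p x" and "u = x - v"
    have x: "x = v + u" by (simp add: u_def)
    have "blinfun_apply w v \<bullet> v = 0"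
      using w_le[of v] w_pos[of v] by (simp add: v_def pp)
    then have "blinfun_apply w x \<bullet> x = blinfun_apply w u \<bullet> u"
      using positive_form_cross_terms_0[OF w(1), of v u]
      by (simp add: x blinfun.add_right inner_add_left inner_add_right)
    also have "\<dots> \<le> c * (u \<bullet> u)" by (rule w_le_c)
    also have "u \<bullet> u = x \<bullet> x - v \<bullet> x"
    proof -
      have "v \<bullet> v = v \<bullet> x"
        by (metis Re_cinner cinner_projection_op p v_def)
      then show ?thesis
        by (simp add: u_def inner_diff_left inner_diff_right inner_commute)
    qed
    finally show "0 \<le> blinfun_apply (c *\<^sub>R (id_blinfun - p) - w) x \<bullet> x"
      by (simp add: v_def blinfun.diff_left blinfun.scaleR_left inner_diff_left)
  qed
qed

section \<open>Strong and ultraweak limits\<close>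

lemma tendsto_apply_if_limitin_strong:
  assumes "limitin strong_operator_topology T S F"
  shows "((\<lambda>t. blinfun_apply (T t) x) \<longlongrightarrow> blinfun_apply S x) F"
  using continuous_map_limit[OF strong_operator_topology_continuous_evaluation assms, of x]
  by (simp add: o_def)

lemma limitin_topology_generated_byI:
  assumes "l \<in> \<Union>\<S>" and "\<And>U. U \<in> \<S> \<Longrightarrow> l \<in> U \<Longrightarrow> eventually (\<lambda>t. f t \<in> U) F"
  shows "limitin (topology_generated_by \<S>) f l F"
proof -
  have "eventually (\<lambda>t. f t \<in> U) F" if "generate_topology_on \<S> U" "l \<in> U" for U
    using that
  proof (induction rule: generate_topology_on.induct)
    case (UN K)
    then obtain k where k: "k \<in> K" "l \<in> k" by blast
    then have "eventually (\<lambda>t. f t \<in> k) F" using UN by blast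
    then show ?case by (rule eventually_mono) (use k in blast)
  qed (auto simp: eventually_conj_iff assms(2))
  with assms(1) show ?thesis
    by (simp add: limitin_def openin_topology_generated_by_iff)
qed

text \<open>
  A functional of the predual is a series of vector functionals.  Strong convergence gives
  convergence term by term, and the bounds \<open>0 \<le> T t \<le> 1\<close> give a summable majorant that does not
  depend on \<open>t\<close>, so the series converges as well.
\<close>

lemma limitin_ultraweak_of_strong:
  fixes T :: "'i \<Rightarrow> ('h::chilbert_space \<Rightarrow>\<^sub>L 'h)"
  assumes lim: "limitin strong_operator_topology T S F" and nontriv: "F \<noteq> bot"
    and bdd: "eventually (\<lambda>t. T t \<in> bounded_ops \<and> positive_op (T t) \<and> op_le (T t) id_blinfun) F"
  shows "limitin ultraweak_topology T S F"
  unfolding ultraweak_topology_def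
proof (rule limitin_topology_generated_byI, goal_cases)
  case 1
  \<comment> \<open>The zero sequences give a subbasic set that contains every operator.\<close>
  let ?U = "{S :: 'h \<Rightarrow>\<^sub>L 'h. (\<Sum>n. cinner (blinfun_apply S 0) 0) \<in> (UNIV :: complex set)}"
  have "summable (\<lambda>n::nat. (norm (0 :: 'h))\<^sup>2)" by simp
  then have "\<exists>\<xi> \<eta> V. ?U = {S. (\<Sum>n. cinner (blinfun_apply S (\<xi> n)) (\<eta> n)) \<in> V}
      \<and> summable (\<lambda>n::nat. (norm (\<xi> n :: 'h))\<^sup>2) \<and> summable (\<lambda>n. (norm (\<eta> n :: 'h))\<^sup>2)
      \<and> open V"
    using open_UNIV
    by (intro exI[of _ "\<lambda>n::nat. 0 :: 'h"] exI[of _ "UNIV :: complex set"]) simp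
  then show ?case
    by (intro UnionI[of ?U]) (simp_all only: mem_Collect_eq UNIV_I)
next
  case (2 U)
  then obtain \<xi> \<eta> :: "nat \<Rightarrow> 'h" and V
    where U: "U = {S. (\<Sum>n. cinner (blinfun_apply S (\<xi> n)) (\<eta> n)) \<in> V}"
      and sum: "summable (\<lambda>n. (norm (\<xi> n))\<^sup>2)" "summable (\<lambda>n. (norm (\<eta> n))\<^sup>2)" and V: "open V"
    by blast
  define M where "M n = 3 * ((norm (\<xi> n))\<^sup>2 + (norm (\<eta> n))\<^sup>2)" for n
  have M: "summable M"
    unfolding M_def by (intro summable_mult summable_add sum)
  have ev: "eventually (\<lambda>t. \<forall>n. norm (cinner (blinfun_apply (T t) (\<xi> n)) (\<eta> n)) \<le> M n) F"
    using bdd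
    unfolding M_def
    by eventually_elim (blast intro: cmod_cinner_le_if_form_le form_le_if_between_0_and_id)
  have "((\<lambda>t. cinner (blinfun_apply (T t) (\<xi> n)) (\<eta> n))
      \<longlongrightarrow> cinner (blinfun_apply S (\<xi> n)) (\<eta> n)) F" for n
    by (intro cinner.tendsto tendsto_const tendsto_apply_if_limitin_strong lim)
  moreover have "eventually (\<lambda>(n, t). norm (cinner (blinfun_apply (T t) (\<xi> n)) (\<eta> n)) \<le> M n)
      (at_top \<times>\<^sub>F F)"
    by (rule eventually_mono[OF eventually_prodI[OF eventually_True ev]]) auto
  ultimately have "((\<lambda>t. \<Sum>n. cinner (blinfun_apply (T t) (\<xi> n)) (\<eta> n))
      \<longlongrightarrow> (\<Sum>n. cinner (blinfun_apply S (\<xi> n)) (\<eta> n))) F"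
    using tannerys_theorem[where a = "\<lambda>n t. cinner (blinfun_apply (T t) (\<xi> n)) (\<eta> n)"
        and b = "\<lambda>n. cinner (blinfun_apply S (\<xi> n)) (\<eta> n)", OF _ _ M nontriv]
    by blast
  then show ?case
    using 2(2) V U by (auto dest: topological_tendstoD)
qed

text \<open>A vector functional is the ultraweak functional of two one-term sequences.\<close>

lemma tendsto_cinner_if_limitin_ultraweak:
  fixes T :: "'i \<Rightarrow> ('h::chilbert_space \<Rightarrow>\<^sub>L 'h)"
  assumes "limitin ultraweak_topology T S F"
  shows "((\<lambda>t. cinner (blinfun_apply (T t) x) z) \<longlongrightarrow> cinner (blinfun_apply S x) z) F"
proof (rule topological_tendstoI)
  fix V assume V: "open V" "cinner (blinfun_apply S x) z \<in> V"
  define \<xi> \<eta> where "\<xi> n = (if n = 0 then x else 0)" and "\<eta> n = (if n = 0 then z else 0)" for n :: nat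
  define U where "U = {R. (\<Sum>n. cinner (blinfun_apply R (\<xi> n)) (\<eta> n)) \<in> V}"
  have "(\<Sum>n. cinner (blinfun_apply R (\<xi> n)) (\<eta> n)) = cinner (blinfun_apply R x) z" for R
    using suminf_finite[of "{0}" "\<lambda>n. cinner (blinfun_apply R (\<xi> n)) (\<eta> n)"]
    by (simp add: \<xi>_def \<eta>_def cinner.zero_right)
  then have U: "R \<in> U \<longleftrightarrow> cinner (blinfun_apply R x) z \<in> V" for R
    by (simp add: U_def)
  have "summable (\<lambda>n. (norm (\<xi> n))\<^sup>2)" "summable (\<lambda>n. (norm (\<eta> n))\<^sup>2)"
    by (rule summable_finite[of "{0}"]; simp add: \<xi>_def \<eta>_def)+
  then have "openin ultraweak_topology U"
    unfolding ultraweak_topology_def U_def using V(1)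
    by (intro topology_generated_by_Basis) blast
  then have "eventually (\<lambda>t. T t \<in> U) F"
    using assms V(2) unfolding limitin_def U[symmetric] by blast
  then show "eventually (\<lambda>t. cinner (blinfun_apply (T t) x) z \<in> V) F"
    by (simp add: U)
qed

section \<open>Positive maps and the semigroup\<close>

lemma scale_op_of_real: "scale_op (complex_of_real r) S = r *\<^sub>R S"
  by (rule blinfun_eqI) (simp add: scale_op.rep_eq scaleC_of_real blinfun.scaleR_left)

text \<open>Operators are the one by one operator matrices.\<close>

lemma completely_positive_on_positive:
  assumes "completely_positive_on A f" and "S \<in> A" and "positive_op S"
  shows "positive_op (f S)"
proof -
  have iff: "positive_op_matrix 1 (\<lambda>i j. R) \<longleftrightarrow> positive_op R" for R :: "'a \<Rightarrow>\<^sub>L 'a"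
  proof
    assume "positive_op_matrix 1 (\<lambda>i j. R)"
    then have "cinner (blinfun_apply R x) x \<in> \<real>\<^sub>\<ge>\<^sub>0" for x
      unfolding positive_op_matrix_def by (auto dest: spec[of _ "\<lambda>_. x"])
    then show "positive_op R" by (simp add: positive_op_def)
  qed (simp add: positive_op_matrix_def positive_op_def)
  from assms have "positive_op_matrix 1 (\<lambda>i j. f S)"
    unfolding completely_positive_on_def
    by (elim conjE allE[of _ 1] allE[of _ "\<lambda>i j. S"]) (simp add: iff[simplified])
  then show ?thesis by (simp only: iff)
qed

lemma linear_map_on_scaleR:
  assumes "linear_map_on A f" and "S \<in> A"
  shows "f (r *\<^sub>R S) = r *\<^sub>R f S"
  using assms unfolding linear_map_on_def by (metis scale_op_of_real)

lemma von_neumann_algebra_scaleR: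
  "von_neumann_algebra A \<Longrightarrow> S \<in> A \<Longrightarrow> r *\<^sub>R S \<in> A"
  unfolding von_neumann_algebra_def by (metis scale_op_of_real)

lemma von_neumann_algebra_diff:
  assumes "von_neumann_algebra A" and "S \<in> A" and "R \<in> A"
  shows "S - R \<in> A"
proof -
  have "S + (- 1) *\<^sub>R R \<in> A"
    using assms von_neumann_algebra_scaleR unfolding von_neumann_algebra_def by blast
  then show ?thesis by simp
qed

lemma linear_map_on_diff:
  assumes "von_neumann_algebra A" and "linear_map_on A f" and "S \<in> A" and "R \<in> A"
  shows "f (S - R) = f S - f R"
proof -
  have "f (S + (- 1) *\<^sub>R R) = f S + (- 1) *\<^sub>R f R"
    using assms(2,3) von_neumann_algebra_scaleR[OF assms(1,4), of "- 1"]
      linear_map_on_scaleR[OF assms(2,4), of "- 1"]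
    unfolding linear_map_on_def by metis
  then show ?thesis by simp
qed

lemma completely_positive_on_mono:
  assumes "von_neumann_algebra A" and "completely_positive_on A f"
    and "S \<in> A" and "R \<in> A" and "op_le S R"
  shows "op_le (f S) (f R)"
proof -
  have "positive_op (f (R - S))"
    by (rule completely_positive_on_positive[OF assms(2) von_neumann_algebra_diff[OF assms(1,4,3)]])
      (use assms(5) in \<open>simp add: op_le_def\<close>)
  then show ?thesis
    using linear_map_on_diff[OF assms(1) _ assms(4,3)] assms(2)
    by (simp add: op_le_def completely_positive_on_def)
qed

text \<open>
  Stated for pointwise convergence so that it applies to every affine expression in
  \<open>\<tau> t p\<close> that occurs in the contraction argument.
\<close>

lemma positive_op_pointwise_limit:
  fixes S :: "'h::chilbert_space \<Rightarrow>\<^sub>L 'h"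
  assumes "\<And>x. ((\<lambda>t. blinfun_apply (T t) x) \<longlongrightarrow> blinfun_apply S x) F" and "F \<noteq> bot"
    and "eventually (\<lambda>t. positive_op (T t)) F"
  shows "positive_op S"
  unfolding positive_op_def
proof
  fix x
  have "((\<lambda>t. cinner (blinfun_apply (T t) x) x) \<longlongrightarrow> cinner (blinfun_apply S x) x) F"
    by (intro cinner.tendsto tendsto_const assms(1))
  moreover have "eventually (\<lambda>t. cinner (blinfun_apply (T t) x) x \<in> \<real>\<^sub>\<ge>\<^sub>0) F"
    using assms(3) by eventually_elim (simp add: positive_op_def)
  ultimately show "cinner (blinfun_apply S x) x \<in> \<real>\<^sub>\<ge>\<^sub>0"
    by (intro Lim_in_closed_set[OF closed_nonneg_Reals_complex _ assms(2)])
qed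

text \<open>
  Passing to the limit in \<open>\<tau> s (\<tau> t x) = \<tau> (s + t) x\<close>: the left side converges by normality of
  \<open>\<tau> s\<close>, the right side by hypothesis.
\<close>

lemma quantum_dynamical_semigroup_fixes_limit:
  fixes A :: "('h::chilbert_space \<Rightarrow>\<^sub>L 'h) set"
    and I :: "real set"
  defines "F \<equiv> inf at_top (principal I)"
  assumes sg: "quantum_dynamical_semigroup I A \<tau>" and "x \<in> A" and "y \<in> A" and s: "s \<in> I"
    and lim: "limitin ultraweak_topology (\<lambda>t. \<tau> t x) y F"
    and nontriv: "F \<noteq> bot"
  shows "\<tau> s y = y"
proof (rule blinfun_eqI)
  fix v
  have I: "I = {0..} \<or> I = \<nat>" and maps: "\<And>t. t \<in> I \<Longrightarrow> \<tau> t x \<in> A"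
    and comp: "\<And>t. t \<in> I \<Longrightarrow> \<tau> (s + t) x = \<tau> s (\<tau> t x)"
    and cont: "continuous_map (weak_star A) (weak_star A) (\<tau> s)"
    using sg s \<open>x \<in> A\<close> unfolding quantum_dynamical_semigroup_def by blast+
  have in_I: "eventually (\<lambda>t. t \<in> I) F"
    by (simp add: F_def eventually_inf_principal)
  have "limitin (weak_star A) (\<lambda>t. \<tau> t x) y F"
    unfolding limitin_subtopology using lim \<open>y \<in> A\<close> in_I maps
    by (auto elim: eventually_mono)
  then have "limitin (weak_star A) (\<tau> s \<circ> (\<lambda>t. \<tau> t x)) (\<tau> s y) F"
    by (rule continuous_map_limit[OF cont])
  then have ws: "limitin ultraweak_topology (\<lambda>t. \<tau> s (\<tau> t x)) (\<tau> s y) F"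
    by (simp add: limitin_subtopology o_def)
  have shift: "filterlim (\<lambda>t. s + t) F F"
  proof -
    have "filterlim (\<lambda>t. s + t) at_top F"
      unfolding F_def
      by (rule filterlim_mono[OF filterlim_tendsto_add_at_top[OF tendsto_const filterlim_ident]])
        simp_all
    moreover have "filterlim (\<lambda>t. s + t) (principal I) F"
      unfolding filterlim_principal using in_I by eventually_elim (use I s in auto)
    ultimately show ?thesis
      by (subst (1) F_def) (simp add: filterlim_inf)
  qed
  have "cinner (blinfun_apply (\<tau> s y) v) z = cinner (blinfun_apply y v) z" for z
  proof (rule tendsto_unique[OF nontriv])
    show "((\<lambda>t. cinner (blinfun_apply (\<tau> s (\<tau> t x)) v) z)
        \<longlongrightarrow> cinner (blinfun_apply (\<tau> s y) v) z) F"
      by (rule tendsto_cinner_if_limitin_ultraweak[OF ws])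
    have "((\<lambda>t. cinner (blinfun_apply (\<tau> (s + t) x) v) z)
        \<longlongrightarrow> cinner (blinfun_apply y v) z) F"
      by (rule filterlim_compose[OF tendsto_cinner_if_limitin_ultraweak[OF lim] shift])
    then show "((\<lambda>t. cinner (blinfun_apply (\<tau> s (\<tau> t x)) v) z)
        \<longlongrightarrow> cinner (blinfun_apply y v) z) F"
      by (rule Lim_transform_eventually) (use in_I in eventually_elim, simp add: comp)
  qed
  then have "blinfun_apply (\<tau> s y) v \<bullet> z = blinfun_apply y v \<bullet> z" for z
    by (metis Re_cinner)
  then show "blinfun_apply (\<tau> s y) v = blinfun_apply y v"
    by (metis inner_commute vector_eq_rdot)
qed

theorem theorem2p5:
  fixes A :: "('h::chilbert_space \<Rightarrow>\<^sub>L 'h) set"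
    and I :: "real set"
    and \<tau> :: "real \<Rightarrow> ('h \<Rightarrow>\<^sub>L 'h) \<Rightarrow> ('h \<Rightarrow>\<^sub>L 'h)"
    and p y :: "'h \<Rightarrow>\<^sub>L 'h"
    and lam :: real
  assumes "separable_space (euclidean :: 'h topology)"
    and "von_neumann_algebra A"
    and "quantum_dynamical_semigroup I A \<tau>"
    and "subharmonic_projection I A \<tau> p"
    and "is_strong_limit I (\<lambda>t. \<tau> t p) y"
    and "lam > 0"
    and "op_le (lam *\<^sub>R id_blinfun) y"
  shows "y = id_blinfun"
proof -
  define F where "F = inf at_top (principal I)"
  note vn = assms(2) and sg = assms(3)
  have I: "I = {0..} \<or> I = \<nat>"
    and maps: "\<And>t x. t \<in> I \<Longrightarrow> x \<in> A \<Longrightarrow> \<tau> t x \<in> A"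
    and unital: "\<And>t. t \<in> I \<Longrightarrow> \<tau> t id_blinfun = id_blinfun"
    and cp: "\<And>t. t \<in> I \<Longrightarrow> completely_positive_on A (\<tau> t)"
    using sg assms(4) unfolding quantum_dynamical_semigroup_def subharmonic_projection_def by blast+
  have lin: "linear_map_on A (\<tau> t)" if "t \<in> I" for t
    using cp[OF that] by (simp add: completely_positive_on_def)
  have p: "p \<in> A" "projection_op p" and sub: "\<And>t. t \<in> I \<Longrightarrow> op_le p (\<tau> t p)"
    using assms(4) by (auto simp: subharmonic_projection_def)
  have A: "id_blinfun \<in> A" "A \<subseteq> bounded_ops" "closedin strong_operator_topology A"
    using vn by (auto simp: von_neumann_algebra_def)
  have lim: "limitin strong_operator_topology (\<lambda>t. \<tau> t p) y F"
    using assms(5) by (simp add: is_strong_limit_def F_def)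
  note lim_at = tendsto_apply_if_limitin_strong[OF lim]
  have in_I: "eventually (\<lambda>t. t \<in> I) F"
    by (simp add: F_def eventually_inf_principal)
  have nontriv: "F \<noteq> bot"
  proof
    assume "F = bot"
    then have "eventually (\<lambda>t. t \<notin> I) at_top"
      by (simp add: F_def trivial_limit_def eventually_inf_principal)
    then obtain N where "\<And>t. t \<ge> N \<Longrightarrow> t \<notin> I" by (auto simp: eventually_at_top_linorder)
    from this[of "real (nat \<lceil>N\<rceil>)"] show False
      using I by (auto simp: real_nat_ceiling_ge)
  qed

  have p_pos: "positive_op p" and p_le_1: "op_le p id_blinfun"
    unfolding op_le_def using p(2) by (intro projection_op_positive projection_op_compl; assumption)+
  have orbit_pos: "positive_op (\<tau> t p)" and orbit_le_1: "op_le (\<tau> t p) id_blinfun" if "t \<in> I" for t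
    using completely_positive_on_positive[OF cp[OF that] p(1) p_pos]
      completely_positive_on_mono[OF vn cp[OF that] p(1) A(1) p_le_1] unital[OF that] by simp_all

  have y: "y \<in> A"
    by (rule limitin_closedin[OF lim A(3) _ nontriv])
      (use in_I in eventually_elim, simp add: maps p(1))
  have "limitin ultraweak_topology (\<lambda>t. \<tau> t p) y F"
    by (rule limitin_ultraweak_of_strong[OF lim nontriv])
      (use in_I in eventually_elim, use A(2) maps p(1) orbit_pos orbit_le_1 in blast)
  then have fixed: "\<tau> t y = y" if "t \<in> I" for t
    using quantum_dynamical_semigroup_fixes_limit[OF sg p(1) y that] nontriv by (simp add: F_def)

  define w where "w = id_blinfun - y"
  have w: "w \<in> A"
    unfolding w_def by (rule von_neumann_algebra_diff[OF vn A(1) y])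
  have w_fixed: "\<tau> t w = w" if "t \<in> I" for t
    unfolding w_def using linear_map_on_diff[OF vn lin[OF that] A(1) y] fixed unital that by simp
  have w_pos: "positive_op w"
  proof (rule positive_op_pointwise_limit[OF _ nontriv])
    show "((\<lambda>t. blinfun_apply (id_blinfun - \<tau> t p) x) \<longlongrightarrow> blinfun_apply w x) F" for x
      unfolding w_def blinfun.diff_left by (intro tendsto_diff tendsto_const lim_at)
    show "eventually (\<lambda>t. positive_op (id_blinfun - \<tau> t p)) F"
      using in_I by eventually_elim (use orbit_le_1 in \<open>simp add: op_le_def\<close>)
  qed
  have "positive_op (y - p)"
  proof (rule positive_op_pointwise_limit[OF _ nontriv])
    show "((\<lambda>t. blinfun_apply (\<tau> t p - p) x) \<longlongrightarrow> blinfun_apply (y - p) x) F" for x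
      unfolding blinfun.diff_left by (intro tendsto_diff tendsto_const lim_at)
    show "eventually (\<lambda>t. positive_op (\<tau> t p - p)) F"
      using in_I by eventually_elim (use sub in \<open>simp add: op_le_def\<close>)
  qed
  then have w_le: "op_le w (id_blinfun - p)"
    by (simp add: op_le_def w_def)
  define c where "c = 1 - lam"
  have "op_le w (c *\<^sub>R id_blinfun)"
    using assms(7) by (simp add: op_le_def w_def c_def algebra_simps)
  then have corner: "op_le w (c *\<^sub>R (id_blinfun - p))"
    by (rule op_le_corner[OF p(2) w_pos w_le])

  have orbit: "op_le w (c *\<^sub>R (id_blinfun - \<tau> t p))" if t: "t \<in> I" for t
  proof -
    have q: "id_blinfun - p \<in> A"
      by (rule von_neumann_algebra_diff[OF vn A(1) p(1)])
    have "op_le (\<tau> t w) (\<tau> t (c *\<^sub>R (id_blinfun - p)))"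
      by (rule completely_positive_on_mono[OF vn cp[OF t] w von_neumann_algebra_scaleR[OF vn q] corner])
    then show ?thesis
      using linear_map_on_scaleR[OF lin[OF t] q] linear_map_on_diff[OF vn lin[OF t] A(1) p(1)]
        w_fixed[OF t] unital[OF t] by simp
  qed
  \<comment> \<open>As \<open>1 - \<tau> t p\<close> converges to \<open>w\<close> itself, the bound on \<open>w\<close> closes up.\<close>
  have contraction: "positive_op (c *\<^sub>R w - w)"
  proof (rule positive_op_pointwise_limit[OF _ nontriv])
    show "((\<lambda>t. blinfun_apply (c *\<^sub>R (id_blinfun - \<tau> t p) - w) x)
        \<longlongrightarrow> blinfun_apply (c *\<^sub>R w - w) x) F" for x
      unfolding blinfun.diff_left blinfun.scaleR_left w_def
      by (intro tendsto_diff tendsto_scaleR tendsto_const lim_at)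
    show "eventually (\<lambda>t. positive_op (c *\<^sub>R (id_blinfun - \<tau> t p) - w)) F"
      using in_I by eventually_elim (use orbit in \<open>simp add: op_le_def\<close>)
  qed
  have "w = 0"
  proof (rule op_eq_0_if_form_0)
    show "w \<in> bounded_ops" using w A(2) by blast
    fix x
    have "c *\<^sub>R w - w = (- lam) *\<^sub>R w"
      by (simp add: c_def algebra_simps)
    then have "0 \<le> blinfun_apply ((- lam) *\<^sub>R w) x \<bullet> x"
      using contraction by (metis positive_op_iff)
    then have "blinfun_apply w x \<bullet> x \<le> 0"
      using \<open>lam > 0\<close> by (simp add: blinfun.scaleR_left blinfun.minus_left mult_le_0_iff)
    with w_pos show "cinner (blinfun_apply w x) x = 0"
      by (metis antisym complex_eq_iff positive_op_iff Re_cinner zero_complex.simps)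
  qed
  then show ?thesis
    by (simp add: w_def)
qed

end
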